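(* Let $K$ be a knot and define $d_{-1}=[F,d_1]$ on $\mathcal{H}(K)$. Then $[E,d_{-1}]=d_1$ and $[F,d_{-1}]=0$, so $d_1,d_{-1}$ span a $2$-dimensional representation of $\mathfrak{sl}(2)$ (under the adjoint action). Furthermore $$d_{-1}^2=d_{-1}d_1+d_1d_{-1}=0.$$ The symmetry of $\mathcal{H}(K)$ exchanges $d_1$ with $d_{-1}$; in particular, $d_{-1}$ is a cancelling differential if $d_1$ is.
   Context: $\mathcal{H}(K)$ is the reduced triply graded (HOMFLY-PT) Khovanov–Rozansky homology of the knot $K$ over $\mathbb{C}$, finite-dimensional and graded by $(q,a,t)$. By Gorsky–Hogancamp–Mellit, $\mathcal{H}(K)$ carries an $\mathfrak{sl}(2)$ action $E,F,H$ with $[E,F]=H$, $[H,E]=2E$, $[H,F]=-2F$, $H=\tfrac12\deg_q$, $E$ raising $q$ by $4$, $F$ lowering it by $4$; it makes $\mathcal{H}(K)$ symmetric under an identification exchanging tridegrees $(q,a,t)$ and $(-q,a,t+2q)$ (the symmetry). $d_1$ is the first differential of Rasmussen's spectral sequence from $\mathcal{H}(K)$ to (one-dimensional) $\mathfrak{sl}(1)$ homology; $d_1^2=0$, $d_1$ changes degrees by $(q,a,t)\mapsto(q+2,a-2,t)$, and $[E,d_1]=0$. *)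

theory Defs
  imports "HOL-Analysis.Analysis"
begin

text \<open>Finite-dimensional complex vector space modelled as complex^'n; linear operators
  as square matrices acting by matrix-vector multiplication.\<close>

definition comm :: "complex^'n^'n \<Rightarrow> complex^'n^'n \<Rightarrow> complex^'n^'n" where
  "comm A B = A ** B - B ** A"

fun mpow :: "complex^'n^'n \<Rightarrow> nat \<Rightarrow> complex^'n^'n" where
  "mpow A 0 = mat 1"
| "mpow A (Suc k) = A ** mpow A k"

text \<open>Exponential of a nilpotent operator (on a space of dimension CARD('n), a nilpotent
  operator satisfies A^CARD('n) = 0, so this truncated series is the exponential).\<close>
definition nil_exp :: "complex^'n^'n \<Rightarrow> complex^'n^'n" where
  "nil_exp A = (\<Sum>k\<le>CARD('n). (1 / fact k) *\<^sub>R mpow A k)"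

text \<open>Weyl element of the sl(2) action: realizes the symmetry of H(K).\<close>
definition weyl :: "complex^'n^'n \<Rightarrow> complex^'n^'n \<Rightarrow> complex^'n^'n" where
  "weyl E F = nil_exp E ** nil_exp (- F) ** nil_exp E"

text \<open>Triple grading: G (q,a,t) is the homogeneous piece of tridegree (q,a,t);
  V is the (internal) direct sum of the pieces, only finitely many of which are nonzero.\<close>
definition trigraded :: "(int \<times> int \<times> int \<Rightarrow> (complex^'n) set) \<Rightarrow> bool" where
  "trigraded G \<longleftrightarrow>
     (\<forall>d. vec.subspace (G d)) \<and> finite {d. G d \<noteq> {0}} \<and>
     (\<forall>x. \<exists>!c. (\<forall>d. c d \<in> G d) \<and> finite {d. c d \<noteq> 0} \<and> x = (\<Sum>d\<in>{d. c d \<noteq> 0}. c d))"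

text \<open>Sum of all pieces of q-degree q.\<close>
definition qpart :: "(int \<times> int \<times> int \<Rightarrow> (complex^'n) set) \<Rightarrow> int \<Rightarrow> (complex^'n) set" where
  "qpart G q = vec.span (\<Union>a t. G (q, a, t))"

text \<open>A cancelling differential: d^2 = 0 and its homology is one-dimensional.\<close>
definition cancelling :: "complex^'n^'n \<Rightarrow> bool" where
  "cancelling d \<longleftrightarrow> d ** d = 0 \<and>
     vec.dim {x. d *v x = 0} = vec.dim (range ((*v) d)) + 1"

end

(* d1 raises the q-degree by 2, so [H, d1] = d1; with [E, d1] = 0 this makes d1 a highest weight
   vector of weight 1 for the adjoint action of sl(2). Since (ad F)^k d1 shifts the q-degree by
   2 - 4k it vanishes for large k, and the relation
   [E, (ad F)^(k+1) d1] = (k+1)(1-k) (ad F)^k d1 carries the vanishing down to k = 2.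
   The Leibniz rule then gives d_{-1} d1 + d1 d_{-1} = [F, d1^2] = 0 and
   2 d_{-1}^2 = [F, d_{-1} d1 + d1 d_{-1}] = 0. Finally E and F are nilpotent for degree reasons,
   so w = e^E e^{-F} e^E is invertible, and conjugating d1, d_{-1} by the exponentials gives
   w d1 = - d_{-1} w and w d_{-1} = d1 w: d_{-1} is similar to -d1. *)

theory Submission
  imports Defs
begin

section \<open>Matrix algebra and commutators\<close>

lemma matrix_add_rdistrib: "(A + B) ** C = A ** C + B ** C"
  by (vector matrix_matrix_mult_def sum.distrib distrib_right)

lemma matrix_diff_ldistrib:
  fixes A :: "'a::ring_1^'n^'m"
  shows "A ** (B - C) = A ** B - A ** C"
  by (vector matrix_matrix_mult_def sum_subtractf right_diff_distrib)

lemma matrix_diff_rdistrib: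
  fixes A :: "'a::ring_1^'n^'m"
  shows "(A - B) ** C = A ** C - B ** C"
  by (vector matrix_matrix_mult_def sum_subtractf left_diff_distrib)

lemma matrix_neg_left:
  fixes A :: "'a::ring_1^'n^'m"
  shows "(- A) ** B = - (A ** B)"
  by (vector matrix_matrix_mult_def sum_negf)

lemma matrix_neg_right:
  fixes A :: "'a::ring_1^'n^'m"
  shows "A ** (- B) = - (A ** B)"
  by (vector matrix_matrix_mult_def sum_negf)

lemma matrix_scaleR_left:
  fixes A :: "'a::real_algebra_1^'n^'m"
  shows "(k *\<^sub>R A) ** B = k *\<^sub>R (A ** B)"
  by (simp add: scalar_matrix_assoc)

lemma matrix_scaleR_right:
  fixes A :: "'a::real_algebra_1^'n^'m"
  shows "A ** (k *\<^sub>R B) = k *\<^sub>R (A ** B)"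
  by (simp add: matrix_scalar_ac scalar_matrix_assoc)

lemma matrix_sum_left: "(\<Sum>i\<in>S. f i) ** B = (\<Sum>i\<in>S. f i ** B)"
  by (induct S rule: infinite_finite_induct) (simp_all add: matrix_add_rdistrib)

lemma matrix_sum_right: "B ** (\<Sum>i\<in>S. f i) = (\<Sum>i\<in>S. B ** f i)"
  by (induct S rule: infinite_finite_induct) (simp_all add: matrix_add_ldistrib)

lemma matrix_vector_mult_sum_left: "(\<Sum>i\<in>S. f i) *v x = (\<Sum>i\<in>S. f i *v x)"
  by (induct S rule: infinite_finite_induct) (simp_all add: matrix_vector_mult_add_rdistrib)

lemma matrix_vector_mult_neg_left:
  fixes A :: "'a::ring_1^'n^'m"
  shows "(- A) *v x = - (A *v x)"
  by (vector matrix_vector_mult_def sum_negf)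

lemma matrix_vector_mult_scaleR_left:
  fixes A :: "'a::real_algebra_1^'n^'m"
  shows "(k *\<^sub>R A) *v x = k *\<^sub>R (A *v x)"
  by (vector matrix_vector_mult_def scaleR_sum_right)

lemma matrix_vector_mult_scaleR_right:
  fixes A :: "'a::real_algebra_1^'n^'m"
  shows "A *v (k *\<^sub>R x) = k *\<^sub>R (A *v x)"
  by (vector matrix_vector_mult_def scaleR_sum_right)

lemmas matrix_ring_simps = matrix_add_ldistrib matrix_add_rdistrib matrix_diff_ldistrib
  matrix_diff_rdistrib matrix_neg_left matrix_neg_right matrix_scaleR_left matrix_scaleR_right
  matrix_mul_assoc

lemma comm_0_right [simp]: "comm A 0 = 0"
  by (simp add: comm_def)

lemma comm_neg_left: "comm (- A) B = - comm A B"
  by (simp add: comm_def matrix_ring_simps)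

lemma comm_neg_right: "comm A (- B) = - comm A B"
  by (simp add: comm_def matrix_ring_simps)

lemma comm_scaleR_left: "comm (c *\<^sub>R A) B = c *\<^sub>R comm A B"
  by (simp add: comm_def matrix_ring_simps scaleR_diff_right)

lemma comm_scaleR_right: "comm A (c *\<^sub>R B) = c *\<^sub>R comm A B"
  by (simp add: comm_def matrix_ring_simps scaleR_diff_right)

lemma comm_add_right: "comm A (B + C) = comm A B + comm A C"
  by (simp add: comm_def matrix_ring_simps)

lemma comm_mult_right: "comm A (B ** C) = comm A B ** C + B ** comm A C"
  by (simp add: comm_def matrix_ring_simps)

lemma comm_jacobi: "comm A (comm B C) = comm (comm A B) C + comm B (comm A C)"
  by (simp add: comm_def matrix_ring_simps algebra_simps)

lemma comm_square_eq_0: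
  assumes DD: "D ** D = 0" and FFD: "comm F (comm F D) = 0"
  shows "comm F D ** D + D ** comm F D = 0" and "comm F D ** comm F D = 0"
proof -
  show anti: "comm F D ** D + D ** comm F D = 0"
    using comm_mult_right[of F D D] DD by simp
  have "2 *\<^sub>R (comm F D ** comm F D) = comm F (comm F D ** D + D ** comm F D)"
    by (simp add: comm_add_right comm_mult_right FFD scaleR_2)
  then show "comm F D ** comm F D = 0"
    using anti by simp
qed

section \<open>Lowering a highest weight vector of the adjoint action\<close>

lemma comm_H_comm_F_power:
  assumes HF: "comm H F = - (2 *\<^sub>R F)" and HD: "comm H D = c *\<^sub>R D"
  shows "comm H ((comm F ^^ k) D) = (c - 2 * real k) *\<^sub>R (comm F ^^ k) D"
proof (induction k)
  case 0
  then show ?case using HD by simp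
next
  case (Suc k)
  have "comm H ((comm F ^^ Suc k) D)
      = comm (comm H F) ((comm F ^^ k) D) + comm F (comm H ((comm F ^^ k) D))"
    using comm_jacobi[of H F "(comm F ^^ k) D"] by simp
  also have "\<dots> = (- 2) *\<^sub>R (comm F ^^ Suc k) D + (c - 2 * real k) *\<^sub>R (comm F ^^ Suc k) D"
    by (simp only: HF Suc.IH comm_neg_left comm_scaleR_left comm_scaleR_right) simp
  also have "\<dots> = (c - 2 * real (Suc k)) *\<^sub>R (comm F ^^ Suc k) D"
    by (simp only: flip: scaleR_add_left) simp
  finally show ?case .
qed

lemma comm_E_comm_F_power:
  assumes EF: "comm E F = H" and HF: "comm H F = - (2 *\<^sub>R F)"
    and HD: "comm H D = c *\<^sub>R D" and ED: "comm E D = 0"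
  shows "comm E ((comm F ^^ Suc k) D) = (real (Suc k) * (c - real k)) *\<^sub>R (comm F ^^ k) D"
proof (induction k)
  case 0
  then show ?case using comm_jacobi[of E F D] by (simp add: EF HD ED)
next
  case (Suc k)
  have coeff: "(c - 2 * real (Suc k)) + real (Suc k) * (c - real k)
      = real (Suc (Suc k)) * (c - real (Suc k))"
    by (simp add: algebra_simps)
  have "comm E ((comm F ^^ Suc (Suc k)) D)
      = comm H ((comm F ^^ Suc k) D) + comm F (comm E ((comm F ^^ Suc k) D))"
    using comm_jacobi[of E F "(comm F ^^ Suc k) D"] by (simp only: EF funpow.simps(2) o_apply)
  also have "\<dots> = (c - 2 * real (Suc k)) *\<^sub>R (comm F ^^ Suc k) D
      + (real (Suc k) * (c - real k)) *\<^sub>R (comm F ^^ Suc k) D"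
    by (simp only: comm_H_comm_F_power[OF HF HD] Suc.IH comm_scaleR_right) simp
  also have "\<dots> = (real (Suc (Suc k)) * (c - real (Suc k))) *\<^sub>R (comm F ^^ Suc k) D"
    by (simp only: coeff flip: scaleR_add_left)
  finally show ?case .
qed

text \<open>The coefficient (k+1)(m-k) of the previous lemma is nonzero for k > m, so vanishing
  propagates down from (ad F)^K D to (ad F)^(m+1) D.\<close>
lemma comm_F_power_highest_weight:
  assumes EF: "comm E F = H" and HF: "comm H F = - (2 *\<^sub>R F)"
    and HD: "comm H D = real m *\<^sub>R D" and ED: "comm E D = 0"
    and nil: "(comm F ^^ K) D = 0"
  shows "(comm F ^^ Suc m) D = 0"
proof (rule inc_induct)
  show "Suc m \<le> K + Suc m" by simp
  have "(comm F ^^ (i + K)) D = 0" for i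
    by (induction i) (simp_all add: nil)
  from this[of "Suc m"] show "(comm F ^^ (K + Suc m)) D = 0"
    by (simp only: add.commute)
next
  fix n
  assume n: "Suc m \<le> n" and vanish: "(comm F ^^ Suc n) D = 0"
  have "(real (Suc n) * (real m - real n)) *\<^sub>R (comm F ^^ n) D = 0"
    using comm_E_comm_F_power[OF EF HF HD ED, of n] vanish by simp
  moreover have "real (Suc n) * (real m - real n) \<noteq> 0"
    using n by simp
  ultimately show "(comm F ^^ n) D = 0"
    by simp
qed

section \<open>Operators homogeneous in the q-degree\<close>

definition qhomogeneous :: "(int \<times> int \<times> int \<Rightarrow> (complex^'n) set) \<Rightarrow> int \<Rightarrow> complex^'n^'n \<Rightarrow> bool"
  where "qhomogeneous G s Y \<longleftrightarrow> (\<forall>q. \<forall>x\<in>qpart G q. Y *v x \<in> qpart G (q + s))"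

lemma subspace_qpart: "vec.subspace (qpart G q)"
  unfolding qpart_def by simp

lemma qpartI: "x \<in> G (q, a, t) \<Longrightarrow> x \<in> qpart G q"
  unfolding qpart_def by (rule vec.span_base) blast

lemma qpart_eq_zero:
  assumes "\<And>a t. G (q, a, t) = {0}"
  shows "qpart G q = {0}"
  using assms unfolding qpart_def by (simp add: vec.span_eq)

lemma qpart_eigenvector:
  assumes H_deg: "\<And>q a t x. x \<in> G (q, a, t) \<Longrightarrow> H *v x = (complex_of_int q / 2) *s x"
    and x: "x \<in> qpart G q"
  shows "H *v x = (complex_of_int q / 2) *s x"
proof -
  have "vec.subspace {x. H *v x = (complex_of_int q / 2) *s x}"
    by (auto simp: vec.subspace_def vec.add vec.scale algebra_simps vector_smult_assoc)
  with x[unfolded qpart_def] show ?thesis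
    by (rule vec.span_induct) (use H_deg in blast)
qed

lemma qhomogeneousI:
  assumes "\<And>q a t x. x \<in> G (q, a, t) \<Longrightarrow> Y *v x \<in> qpart G (q + s)"
  shows "qhomogeneous G s Y"
  unfolding qhomogeneous_def
proof (intro allI ballI)
  fix q x
  assume "x \<in> qpart G q"
  moreover have "vec.subspace {x. Y *v x \<in> qpart G (q + s)}"
    using subspace_qpart[of G "q + s"] by (auto simp: vec.subspace_def vec.add vec.scale)
  ultimately show "Y *v x \<in> qpart G (q + s)"
    unfolding qpart_def[of G q] by (rule vec.span_induct) (use assms in blast)
qed

lemma qhomogeneous_mat_1: "qhomogeneous G 0 (mat 1)"
  by (simp add: qhomogeneous_def)

lemma qhomogeneous_mult:
  "qhomogeneous G s A \<Longrightarrow> qhomogeneous G t B \<Longrightarrow> qhomogeneous G (s + t) (A ** B)"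
  unfolding qhomogeneous_def matrix_vector_mul_assoc[symmetric]
  by (metis add.commute add.left_commute)

lemma qhomogeneous_uminus: "qhomogeneous G s A \<Longrightarrow> qhomogeneous G s (- A)"
  by (simp add: qhomogeneous_def matrix_vector_mult_neg_left vec.subspace_neg[OF subspace_qpart])

lemma qhomogeneous_diff:
  "qhomogeneous G s A \<Longrightarrow> qhomogeneous G s B \<Longrightarrow> qhomogeneous G s (A - B)"
  by (simp add: qhomogeneous_def matrix_vector_mult_diff_rdistrib vec.subspace_diff[OF subspace_qpart])

lemma qhomogeneous_comm:
  assumes "qhomogeneous G s A" and "qhomogeneous G t B"
  shows "qhomogeneous G (s + t) (comm A B)"
proof -
  have "qhomogeneous G (s + t) (B ** A)"
    using qhomogeneous_mult[OF assms(2,1)] by (simp add: add.commute)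
  then show ?thesis
    unfolding comm_def by (rule qhomogeneous_diff[OF qhomogeneous_mult[OF assms]])
qed

lemma qhomogeneous_mpow:
  assumes "qhomogeneous G s A"
  shows "qhomogeneous G (int k * s) (mpow A k)"
proof (induction k)
  case 0
  then show ?case by (simp add: qhomogeneous_mat_1)
next
  case (Suc k)
  then show ?case
    using qhomogeneous_mult[OF assms Suc.IH] by (simp add: algebra_simps)
qed

lemma qhomogeneous_comm_power:
  assumes "qhomogeneous G s A" and "qhomogeneous G t B"
  shows "qhomogeneous G (t + int k * s) ((comm A ^^ k) B)"
proof (induction k)
  case 0
  then show ?case using assms(2) by simp
next
  case (Suc k)
  then show ?case
    using qhomogeneous_comm[OF assms(1) Suc.IH] by (simp add: algebra_simps)
qed

lemma trigraded_matrix_eq: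
  assumes "trigraded G"
    and agree: "\<And>q a t x. x \<in> G (q, a, t) \<Longrightarrow> A *v x = B *v x"
  shows "A = B"
  unfolding matrix_eq
proof
  fix x
  obtain c where c: "\<forall>d. c d \<in> G d" "x = (\<Sum>d\<in>{d. c d \<noteq> 0}. c d)"
    using assms(1) unfolding trigraded_def by metis
  have "A *v c d = B *v c d" for d
    using c(1) agree by (metis prod_cases3)
  then show "A *v x = B *v x"
    using c(2) by (simp add: vec.sum)
qed

lemma trigraded_qdeg_bound:
  assumes "trigraded G"
  obtains Q where "\<And>q a t. G (q, a, t) \<noteq> {0} \<Longrightarrow> \<bar>q\<bar> < Q"
proof
  let ?D = "(\<lambda>d. \<bar>fst d\<bar>) ` {d. G d \<noteq> {0}}"
  fix q a t
  assume "G (q, a, t) \<noteq> {0}"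
  then have "\<bar>q\<bar> \<in> ?D"
    by (auto intro: rev_image_eqI[of "(q, a, t)"])
  moreover have "finite ?D"
    using assms unfolding trigraded_def by blast
  ultimately show "\<bar>q\<bar> < Max ?D + 1"
    by (simp add: Max_ge)
qed

lemma qhomogeneous_eq_0:
  assumes "trigraded G"
  obtains N where "\<And>s (Y :: complex^'n^'n). N \<le> \<bar>s\<bar> \<Longrightarrow> qhomogeneous G s Y \<Longrightarrow> Y = 0"
proof -
  obtain Q where Q: "\<And>q a t. G (q, a, t) \<noteq> {0} \<Longrightarrow> \<bar>q\<bar> < Q"
    using trigraded_qdeg_bound[OF assms] by blast
  have "Y = 0" if s: "2 * Q \<le> \<bar>s\<bar>" and Y: "qhomogeneous G s Y" for s and Y :: "complex^'n^'n"
  proof (rule trigraded_matrix_eq[OF assms])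
    fix q a t x
    assume x: "x \<in> G (q, a, t)"
    show "Y *v x = 0 *v x"
    proof (cases "G (q, a, t) = {0}")
      case True
      then show ?thesis using x by simp
    next
      case False
      then have "\<bar>q\<bar> < Q"
        by (rule Q)
      then have "\<not> \<bar>q + s\<bar> < Q"
        using s by arith
      then have "qpart G (q + s) = {0}"
        by (intro qpart_eq_zero) (use Q[of "q + s"] in blast)
      then show ?thesis
        using Y qpartI[of x G q a t, OF x] unfolding qhomogeneous_def by auto
    qed
  qed
  then show ?thesis
    by (rule that)
qed

lemma qhomogeneous_progression_eq_0:
  fixes Y :: "nat \<Rightarrow> complex^'n^'n"
  assumes "trigraded G" and "s \<noteq> 0" and Y: "\<And>k. qhomogeneous G (t + int k * s) (Y k)"
  obtains K where "Y K = 0"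
proof -
  obtain N where N: "\<And>s (Y :: complex^'n^'n). N \<le> \<bar>s\<bar> \<Longrightarrow> qhomogeneous G s Y \<Longrightarrow> Y = 0"
    using qhomogeneous_eq_0[OF assms(1)] by blast
  define k where "k = nat (\<bar>N\<bar> + \<bar>t\<bar>)"
  have "int k * 1 \<le> int k * \<bar>s\<bar>"
    using \<open>s \<noteq> 0\<close> by (intro mult_left_mono) simp_all
  then have "int k \<le> \<bar>int k * s\<bar>"
    by (simp add: abs_mult)
  then have "N \<le> \<bar>t + int k * s\<bar>"
    unfolding k_def by arith
  then show ?thesis
    using that N Y by blast
qed

lemma comm_H_qhomogeneous:
  assumes "trigraded G"
    and H_deg: "\<And>q a t x. x \<in> G (q, a, t) \<Longrightarrow> H *v x = (complex_of_int q / 2) *s x"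
    and D: "qhomogeneous G s D"
  shows "comm H D = (real_of_int s / 2) *\<^sub>R D"
proof (rule trigraded_matrix_eq[OF assms(1)])
  fix q a t x
  assume x: "x \<in> G (q, a, t)"
  have Dx: "D *v x \<in> qpart G (q + s)"
    using D qpartI[of x G q a t, OF x] unfolding qhomogeneous_def by blast
  have "comm H D *v x = H *v (D *v x) - D *v (H *v x)"
    by (simp add: comm_def matrix_vector_mult_diff_rdistrib matrix_vector_mul_assoc)
  also have "\<dots> = (complex_of_int (q + s) / 2) *s (D *v x) - (complex_of_int q / 2) *s (D *v x)"
    using qpart_eigenvector[OF H_deg Dx] H_deg[OF x] by (simp add: vec.scale)
  also have "\<dots> = (real_of_int s / 2) *\<^sub>R (D *v x)"
    by (simp only: vec_eq_iff vector_scaleR_component vector_smult_component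
        vector_minus_component) (simp add: scaleR_conv_of_real algebra_simps)
  also have "\<dots> = ((real_of_int s / 2) *\<^sub>R D) *v x"
    by (rule matrix_vector_mult_scaleR_left[symmetric])
  finally show "comm H D *v x = ((real_of_int s / 2) *\<^sub>R D) *v x" .
qed

section \<open>Nilpotent matrices and their exponentials\<close>

lemma mpow_Suc_right: "mpow A (Suc k) = mpow A k ** A"
  by (induction k) (simp_all add: matrix_mul_assoc)

lemma mpow_add: "mpow A (i + j) = mpow A i ** mpow A j"
  by (induction i) (simp_all add: matrix_mul_assoc)

lemma range_mpow_Suc: "range ((*v) (mpow A (Suc j))) = (*v) A ` range ((*v) (mpow A j))"
  by (simp only: mpow.simps image_image matrix_vector_mul_assoc)

lemma range_mpow_Suc_subset: "range ((*v) (mpow A (Suc j))) \<subseteq> range ((*v) (mpow A j))"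
  unfolding mpow_Suc_right by (auto simp flip: matrix_vector_mul_assoc)

lemma range_mpow_stable:
  assumes "range ((*v) (mpow A (Suc j))) = range ((*v) (mpow A j))"
  shows "range ((*v) (mpow A (i + j))) = range ((*v) (mpow A j))"
proof (induction i)
  case 0
  then show ?case by simp
next
  case (Suc i)
  have "range ((*v) (mpow A (Suc i + j))) = (*v) A ` range ((*v) (mpow A (i + j)))"
    using range_mpow_Suc[of A "i + j"] by simp
  also have "\<dots> = range ((*v) (mpow A (Suc j)))"
    by (simp only: Suc.IH range_mpow_Suc)
  finally show ?case
    using assms by simp
qed

text \<open>The ranges of the powers of a nilpotent matrix decrease strictly until they reach zero.\<close>
lemma dim_range_mpow:
  fixes A :: "complex^'n^'n"
  assumes nil: "mpow A N = 0"
  shows "range ((*v) (mpow A j)) = {0} \<or> vec.dim (range ((*v) (mpow A j))) + j \<le> CARD('n)"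
proof (induction j)
  case 0
  then show ?case by (simp add: vec.dim_UNIV card_cart_basis)
next
  case (Suc j)
  let ?R = "\<lambda>j. range ((*v) (mpow A j))"
  show ?case
  proof (cases "?R (Suc j) = {0}")
    case True
    then show ?thesis ..
  next
    case False
    have span_R: "vec.span (?R k) = ?R k" for k
      using vec.subspace_image[OF vec.subspace_UNIV] by (simp only: vec.span_eq_iff)
    have "?R (Suc j) \<noteq> ?R j"
    proof
      assume "?R (Suc j) = ?R j"
      then have "?R (N + j) = ?R j"
        by (rule range_mpow_stable)
      moreover have "?R (N + j) = {0}"
        by (auto simp: mpow_add nil)
      ultimately show False
        using False \<open>?R (Suc j) = ?R j\<close> by simp
    qed
    then have psubset: "?R (Suc j) \<subset> ?R j"
      using range_mpow_Suc_subset by blast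
    then have less: "vec.dim (?R (Suc j)) < vec.dim (?R j)"
      by (intro vec.dim_psubset) (simp only: span_R)
    have "0 \<in> ?R (Suc j)"
      by (rule range_eqI[where x = 0]) simp
    with psubset False have "?R j \<noteq> {0}"
      by blast
    with Suc.IH less show ?thesis
      by simp
  qed
qed

lemma mpow_card_eq_0:
  fixes A :: "complex^'n^'n"
  assumes "mpow A N = 0"
  shows "mpow A CARD('n) = 0"
proof -
  have "range ((*v) (mpow A CARD('n))) \<subseteq> {0}"
    using dim_range_mpow[OF assms, of "CARD('n)"] vec.dim_eq_0 by auto
  then show ?thesis
    by (auto simp: matrix_eq)
qed

lemma qhomogeneous_nilpotent:
  fixes A :: "complex^'n^'n"
  assumes "trigraded G" and "qhomogeneous G s A" and "s \<noteq> 0"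
  shows "mpow A CARD('n) = 0"
proof -
  obtain K where "mpow A K = 0"
    using qhomogeneous_progression_eq_0[OF assms(1,3), of 0 "mpow A"]
      qhomogeneous_mpow[OF assms(2)] by auto
  then show ?thesis
    by (rule mpow_card_eq_0)
qed

lemma mpow_Suc_mult_swap:
  assumes XY: "comm X Y = Z" and XZ: "comm X Z = 0"
  shows "mpow X (Suc k) ** Y = Y ** mpow X (Suc k) + real (Suc k) *\<^sub>R (Z ** mpow X k)"
proof -
  have XY': "X ** Y = Y ** X + Z" and XZ': "X ** Z = Z ** X"
    using XY XZ by (simp_all add: comm_def algebra_simps)
  show ?thesis
  proof (induction k)
    case 0
    then show ?case by (simp add: XY')
  next
    case (Suc k)
    have "mpow X (Suc (Suc k)) ** Y = X ** (mpow X (Suc k) ** Y)"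
      by (simp only: mpow.simps(2) matrix_mul_assoc)
    also have "\<dots> = (X ** Y) ** mpow X (Suc k) + real (Suc k) *\<^sub>R ((X ** Z) ** mpow X k)"
      by (simp only: Suc.IH matrix_add_ldistrib matrix_scaleR_right matrix_mul_assoc)
    also have "\<dots> = Y ** mpow X (Suc (Suc k))
        + (Z ** mpow X (Suc k) + real (Suc k) *\<^sub>R (Z ** mpow X (Suc k)))"
      by (simp only: XY' XZ' matrix_add_rdistrib add.assoc flip: matrix_mul_assoc mpow.simps(2))
    also have "\<dots> = Y ** mpow X (Suc (Suc k)) + real (Suc (Suc k)) *\<^sub>R (Z ** mpow X (Suc k))"
      by (simp only: of_nat_Suc[of "Suc k"] scaleR_add_left scaleR_one)
    finally show ?case .
  qed
qed

text \<open>This is e^X Y e^(-X) = Y + [X, Y] when [X, [X, Y]] = 0; the truncation of the series in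
  nil_exp is harmless because the top power of X vanishes.\<close>
lemma nil_exp_mult_swap:
  fixes X :: "complex^'n^'n"
  assumes nil: "mpow X CARD('n) = 0" and XY: "comm X Y = Z" and XZ: "comm X Z = 0"
  shows "nil_exp X ** Y = (Y + Z) ** nil_exp X"
proof -
  obtain m where m: "CARD('n) = Suc m"
    using gr0_implies_Suc[OF zero_less_card_finite[where 'a = 'n]] by blast
  define c where "c i = (1 / fact (Suc i) :: real)" for i
  have exp_shift: "nil_exp X = mat 1 + (\<Sum>i\<le>m. c i *\<^sub>R mpow X (Suc i))"
    by (simp only: nil_exp_def m sum.atMost_Suc_shift c_def) simp
  have exp_trunc: "nil_exp X = (\<Sum>i\<le>m. (1 / fact i) *\<^sub>R mpow X i)"
    using nil by (simp add: nil_exp_def m)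
  have coeff: "c i * real (Suc i) = 1 / fact i" for i
    by (simp add: c_def field_simps del: of_nat_Suc)
  have "nil_exp X ** Y = Y + (\<Sum>i\<le>m. c i *\<^sub>R (mpow X (Suc i) ** Y))"
    by (simp add: exp_shift matrix_add_rdistrib matrix_sum_left matrix_scaleR_left)
  also have "\<dots> = Y + (\<Sum>i\<le>m. c i *\<^sub>R (Y ** mpow X (Suc i)))
      + (\<Sum>i\<le>m. (c i * real (Suc i)) *\<^sub>R (Z ** mpow X i))"
    by (simp only: mpow_Suc_mult_swap[OF XY XZ] scaleR_add_right scaleR_scaleR sum.distrib)
      (simp add: add.assoc)
  also have "\<dots> = Y ** nil_exp X + Z ** nil_exp X"
  proof -
    have "Y ** nil_exp X = Y + (\<Sum>i\<le>m. c i *\<^sub>R (Y ** mpow X (Suc i)))"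
      by (simp only: exp_shift matrix_add_ldistrib matrix_sum_right matrix_scaleR_right
          matrix_mul_rid)
    moreover have "Z ** nil_exp X = (\<Sum>i\<le>m. (c i * real (Suc i)) *\<^sub>R (Z ** mpow X i))"
      by (simp only: exp_trunc coeff matrix_sum_right matrix_scaleR_right)
    ultimately show ?thesis
      by simp
  qed
  finally show ?thesis
    by (simp add: matrix_add_rdistrib)
qed

lemma nil_exp_injective:
  fixes X :: "complex^'n^'n"
  assumes nil: "mpow X CARD('n) = 0" and x: "nil_exp X *v x = 0"
  shows "x = 0"
proof -
  obtain m where m: "CARD('n) = Suc m"
    using gr0_implies_Suc[OF zero_less_card_finite[where 'a = 'n]] by blast
  have "mpow X 0 *v x = 0"
  proof (rule inc_induct[of 0 "CARD('n)"])
    show "mpow X CARD('n) *v x = 0"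
      using nil by simp
  next
    fix n
    assume vanish: "mpow X (Suc n) *v x = 0"
    have higher: "mpow X (n + Suc i) *v x = 0" for i
      using vanish mpow_add[of X i "Suc n"]
      by (simp add: add.commute matrix_vector_mul_assoc[symmetric])
    have "0 = mpow X n *v (nil_exp X *v x)"
      using x by simp
    also have "\<dots> = (\<Sum>k\<le>CARD('n). (1 / fact k) *\<^sub>R (mpow X (n + k) *v x))"
      by (simp add: nil_exp_def vec.sum matrix_vector_mult_sum_left matrix_vector_mult_scaleR_left
          matrix_vector_mult_scaleR_right matrix_vector_mul_assoc mpow_add)
    also have "\<dots> = mpow X n *v x"
      by (simp only: m sum.atMost_Suc_shift higher) simp
    finally show "mpow X n *v x = 0"
      by simp
  qed simp
  then show ?thesis
    by simp
qed

section \<open>The Weyl element and similarity\<close>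

lemma weyl_intertwines:
  fixes E F D D' :: "complex^'n^'n"
  assumes nilE: "mpow E CARD('n) = 0" and nilF: "mpow (- F) CARD('n) = 0"
    and ED: "comm E D = 0" and ED': "comm E D' = D"
    and FD: "comm F D = D'" and FD': "comm F D' = 0"
  shows "weyl E F ** D = - (D' ** weyl E F)" and "weyl E F ** D' = D ** weyl E F"
proof -
  let ?eE = "nil_exp E" and ?eF = "nil_exp (- F)"
  have eE_D: "?eE ** D = D ** ?eE"
    using nil_exp_mult_swap[OF nilE ED comm_0_right] by simp
  have eE_D': "?eE ** D' = (D' + D) ** ?eE"
    using nil_exp_mult_swap[OF nilE ED' ED] .
  have eF_D: "?eF ** D = (D - D') ** ?eF"
    using nil_exp_mult_swap[OF nilF, of D "- D'"] FD FD' by (simp add: comm_neg_left comm_neg_right)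
  have eF_D': "?eF ** D' = D' ** ?eF"
    using nil_exp_mult_swap[OF nilF, of D' 0] FD' by (simp add: comm_neg_left)
  have "weyl E F ** D = ?eE ** ?eF ** (?eE ** D)"
    by (simp add: weyl_def matrix_mul_assoc)
  also have "\<dots> = ?eE ** (?eF ** D) ** ?eE"
    unfolding eE_D by (simp add: matrix_mul_assoc)
  also have "\<dots> = (?eE ** D - ?eE ** D') ** ?eF ** ?eE"
    unfolding eF_D by (simp add: matrix_ring_simps)
  also have "\<dots> = - (D' ** weyl E F)"
    unfolding eE_D eE_D' weyl_def by (simp add: matrix_ring_simps algebra_simps)
  finally show "weyl E F ** D = - (D' ** weyl E F)" .
  have "weyl E F ** D' = ?eE ** ?eF ** (?eE ** D')"
    by (simp add: weyl_def matrix_mul_assoc)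
  also have "\<dots> = ?eE ** (?eF ** D' + ?eF ** D) ** ?eE"
    unfolding eE_D' by (simp add: matrix_ring_simps)
  also have "\<dots> = (?eE ** D) ** ?eF ** ?eE"
    unfolding eF_D eF_D' by (simp add: matrix_ring_simps algebra_simps)
  also have "\<dots> = D ** weyl E F"
    unfolding eE_D weyl_def by (simp add: matrix_mul_assoc)
  finally show "weyl E F ** D' = D ** weyl E F" .
qed

lemma weyl_injective:
  fixes E F :: "complex^'n^'n"
  assumes nilE: "mpow E CARD('n) = 0" and nilF: "mpow (- F) CARD('n) = 0"
    and "weyl E F *v x = 0"
  shows "x = 0"
proof -
  have "nil_exp E *v (nil_exp (- F) *v (nil_exp E *v x)) = 0"
    using assms(3) by (simp add: weyl_def matrix_vector_mul_assoc matrix_mul_assoc)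
  then show ?thesis
    by (meson nil_exp_injective nilE nilF)
qed

lemma cancelling_similar:
  fixes w A B :: "complex^'n^'n"
  assumes inj: "\<And>x. w *v x = 0 \<Longrightarrow> x = 0" and AB: "w ** A = B ** w" and "cancelling A"
  shows "cancelling B"
proof -
  obtain w' where left: "w' ** w = mat 1"
    using inj matrix_left_invertible_ker by blast
  then have right: "w ** w' = mat 1"
    by (rule matrix_left_right_inverse[THEN iffD2])
  have B: "B = w ** A ** w'"
    by (metis AB right matrix_mul_assoc matrix_mul_rid)
  have w'w: "w' *v (w *v x) = x" and ww': "w *v (w' *v x) = x" for x
    by (simp_all add: matrix_vector_mul_assoc left right)
  have Bv: "B *v x = w *v (A *v (w' *v x))" for x
    by (simp add: B matrix_vector_mul_assoc matrix_mul_assoc)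
  have dim_image: "vec.dim ((*v) w ` S) = vec.dim S" for S
    using left matrix_left_invertible_injective[of w]
    by (intro vec.dim_image_eq) (auto intro: inj_on_subset)
  have "{x. B *v x = 0} = (*v) w ` {x. A *v x = 0}"
  proof (intro set_eqI iffI)
    fix x
    assume "x \<in> {x. B *v x = 0}"
    then have "w' *v x \<in> {x. A *v x = 0}"
      using inj by (simp add: Bv)
    then show "x \<in> (*v) w ` {x. A *v x = 0}"
      by (metis ww' image_eqI)
  qed (auto simp: Bv w'w)
  moreover have "range ((*v) B) = (*v) w ` range ((*v) A)"
  proof (intro set_eqI iffI)
    fix y
    assume "y \<in> (*v) w ` range ((*v) A)"
    then obtain x where "y = B *v (w *v x)"
      by (auto simp: Bv w'w)
    then show "y \<in> range ((*v) B)"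
      by blast
  qed (auto simp: Bv)
  moreover have "B ** B = w ** (A ** A) ** w'"
  proof -
    have "B ** B = w ** A ** (w' ** w) ** A ** w'"
      by (simp add: B matrix_mul_assoc)
    then show ?thesis
      by (simp add: left matrix_mul_assoc)
  qed
  ultimately show ?thesis
    using \<open>cancelling A\<close> by (simp add: cancelling_def dim_image)
qed

lemma cancelling_uminus:
  assumes "cancelling (- A)"
  shows "cancelling A"
proof -
  have neg: "(- A) *v x = A *v (- x)" for x
    by (simp add: matrix_vector_mult_neg_left vec.neg)
  have "range ((*v) (- A)) = range ((*v) A)"
  proof
    show "range ((*v) (- A)) \<subseteq> range ((*v) A)"
      by (auto simp: neg)
    show "range ((*v) A) \<subseteq> range ((*v) (- A))"
      by (auto intro: range_eqI[where x = "- _"] simp: neg)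
  qed
  moreover have "{x. (- A) *v x = 0} = {x. A *v x = 0}"
    by (simp add: matrix_vector_mult_neg_left)
  ultimately show ?thesis
    using assms by (simp add: cancelling_def matrix_neg_left matrix_neg_right)
qed

theorem corollary3p29:
  fixes G :: "int \<times> int \<times> int \<Rightarrow> (complex^'n) set"
    and E F H d1 :: "complex^'n^'n"
  assumes grading: "trigraded G"
    and H_deg: "\<And>q a t x. x \<in> G (q, a, t) \<Longrightarrow> H *v x = (complex_of_int q / 2) *s x"
    and E_deg: "\<And>q a t x. x \<in> G (q, a, t) \<Longrightarrow> E *v x \<in> qpart G (q + 4)"
    and F_deg: "\<And>q a t x. x \<in> G (q, a, t) \<Longrightarrow> F *v x \<in> qpart G (q - 4)"
    and EF: "comm E F = H"
    and HE: "comm H E = 2 *\<^sub>R E"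
    and HF: "comm H F = - (2 *\<^sub>R F)"
    and d1_sq: "d1 ** d1 = 0"
    and d1_deg: "\<And>q a t x. x \<in> G (q, a, t) \<Longrightarrow> d1 *v x \<in> G (q + 2, a - 2, t)"
    and E_d1: "comm E d1 = 0"
  shows "let dm1 = comm F d1; w = weyl E F in
           comm E dm1 = d1 \<and> comm F dm1 = 0 \<and> comm H d1 = d1 \<and> comm H dm1 = - dm1 \<and>
           dm1 ** dm1 = 0 \<and> dm1 ** d1 + d1 ** dm1 = 0 \<and>
           w ** d1 = - (dm1 ** w) \<and> w ** dm1 = d1 ** w \<and>
           (cancelling d1 \<longrightarrow> cancelling dm1)"
proof -
  define dm1 where "dm1 = comm F d1"
  have E_hom: "qhomogeneous G 4 E"
    using E_deg by (rule qhomogeneousI)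
  have F_hom: "qhomogeneous G (- 4) F"
    using F_deg by (intro qhomogeneousI) simp
  have d1_hom: "qhomogeneous G 2 d1"
    using d1_deg by (intro qhomogeneousI qpartI)
  have H_d1: "comm H d1 = real 1 *\<^sub>R d1"
    using comm_H_qhomogeneous[OF grading H_deg d1_hom] by simp
  obtain K where K: "(comm F ^^ K) d1 = 0"
    using qhomogeneous_progression_eq_0[OF grading _
        qhomogeneous_comm_power[OF F_hom d1_hom]] by auto
  have F_dm1: "comm F dm1 = 0"
    using comm_F_power_highest_weight[OF EF HF H_d1 E_d1 K] by (simp add: dm1_def)
  have E_dm1: "comm E dm1 = d1"
    using comm_E_comm_F_power[OF EF HF H_d1 E_d1, of 0] by (simp add: dm1_def)
  have H_dm1: "comm H dm1 = - dm1"
    using comm_H_comm_F_power[OF HF H_d1, of 1] by (simp add: dm1_def)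
  have nil_E: "mpow E CARD('n) = 0"
    by (rule qhomogeneous_nilpotent[OF grading E_hom]) simp
  have nil_F: "mpow (- F) CARD('n) = 0"
    by (rule qhomogeneous_nilpotent[OF grading qhomogeneous_uminus[OF F_hom]]) simp
  note square = comm_square_eq_0[OF d1_sq F_dm1[unfolded dm1_def], folded dm1_def]
  note weyl = weyl_intertwines[OF nil_E nil_F E_d1 E_dm1 dm1_def[symmetric] F_dm1]
  have "cancelling d1 \<longrightarrow> cancelling dm1"
    using cancelling_similar[OF weyl_injective[OF nil_E nil_F] weyl(1)[folded matrix_neg_left]]
      cancelling_uminus by blast
  then show ?thesis
    unfolding Let_def dm1_def[symmetric] using E_dm1 F_dm1 H_d1 H_dm1 square weyl by simp
qed

end
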